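(* Let $d\ge 1$ be an integer, let $B\subset\mathbb{R}^d$ be a convex body, and let $\alpha\ge 0$ be a real number. Then $g_\alpha(B)\le h_\alpha(B)$.
   Context: A convex body $B\subset\mathbb{R}^d$ is a compact convex set with non-empty interior. For real $\alpha\ge 0$, $$g_\alpha(B)=\inf\left\{\sum_{i=1}^k \lambda_i^\alpha : k\in\mathbb{N},\ B\subseteq \bigcup_{i=1}^k(\lambda_i B+x_i),\ \lambda_i\in(0,1),\ x_i\in\mathbb{R}^d\right\}.$$ A direction is given by a unit vector $l\in\mathbb{R}^d$. A boundary point $x$ of $B$ is illuminated by the direction $l$ if the ray $\{x+tl: t>0\}$ intersects the interior of $B$. The number $h_\alpha(B)$ is the minimal cardinality of a finite set $\mathcal{L}$ of directions such that the set of boundary points of $B$ not illuminated by any direction in $\mathcal{L}$ has Hausdorff dimension less than $\alpha$; for $\alpha=0$ this means that every boundary point of $B$ is illuminated by some direction of $\mathcal{L}$. Convention for degenerate cases: for $0\le\alpha\le d$ the set $\mathcal{L}$ is required to be non-empty, and for $\alpha>d$ one sets $h_\alpha(B)=0$. *)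

theory Defs
  imports "HOL-Analysis.Analysis"
begin

definition convex_body :: "'a::euclidean_space set \<Rightarrow> bool" where
  "convex_body B \<longleftrightarrow> compact B \<and> convex B \<and> interior B \<noteq> {}"

text \<open>
  The usual conventions at \<open>s = 0\<close>: the empty set contributes 0 and every non-empty set
  contributes 1 (note that \<^term>\<open>(0::real) powr 0\<close> is 0 in HOL).
\<close>

definition diam_power :: "real \<Rightarrow> 'a::metric_space set \<Rightarrow> ennreal" where
  "diam_power s U =
     (if U = {} then 0 else if s = 0 then 1 else ennreal (diameter U powr s))"

text \<open>
  Boundedness is required explicitly because \<^const>\<open>diameter\<close> is real-valued and
  unspecified on unbounded sets. Finite covers are included by padding with empty sets.
\<close>

definition hausdorff_premeasure :: "real \<Rightarrow> real \<Rightarrow> 'a::metric_space set \<Rightarrow> ennreal" where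
  "hausdorff_premeasure s \<delta> A =
     (INF U \<in> {U :: nat \<Rightarrow> 'a set.
                 A \<subseteq> (\<Union>i. U i) \<and> (\<forall>i. bounded (U i) \<and> diameter (U i) \<le> \<delta>)}.
        (\<Sum>i. diam_power s (U i)))"

definition hausdorff_measure :: "real \<Rightarrow> 'a::metric_space set \<Rightarrow> ennreal" where
  "hausdorff_measure s A = (SUP \<delta> \<in> {0<..}. hausdorff_premeasure s \<delta> A)"

definition hausdorff_dim :: "'a::metric_space set \<Rightarrow> ereal" where
  "hausdorff_dim A = (INF s \<in> {s. 0 \<le> s \<and> hausdorff_measure s A = 0}. ereal s)"

definition g_alpha :: "real \<Rightarrow> 'a::euclidean_space set \<Rightarrow> real" where
  "g_alpha \<alpha> B =
     Inf {(\<Sum>i<k. r i powr \<alpha>) | (k::nat) (r :: nat \<Rightarrow> real) (x :: nat \<Rightarrow> 'a).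
            B \<subseteq> (\<Union>i<k. (\<lambda>b. r i *\<^sub>R b + x i) ` B) \<and> (\<forall>i<k. 0 < r i \<and> r i < 1)}"

definition illuminates :: "'a::euclidean_space \<Rightarrow> 'a set \<Rightarrow> 'a \<Rightarrow> bool" where
  "illuminates l B x \<longleftrightarrow> {x + t *\<^sub>R l | t. 0 < t} \<inter> interior B \<noteq> {}"

definition unilluminated :: "'a::euclidean_space set \<Rightarrow> 'a set \<Rightarrow> 'a set" where
  "unilluminated L B = {x \<in> frontier B. \<not> (\<exists>l\<in>L. illuminates l B x)}"

text \<open>
  The case \<open>\<alpha> = 0\<close> is separate since the empty set has \<^const>\<open>hausdorff_dim\<close> 0 here.
\<close>

definition alpha_illuminating :: "real \<Rightarrow> 'a::euclidean_space set \<Rightarrow> 'a set \<Rightarrow> bool" where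
  "alpha_illuminating \<alpha> L B \<longleftrightarrow>
     finite L \<and> L \<noteq> {} \<and> (\<forall>l\<in>L. norm l = 1) \<and>
     (if \<alpha> = 0 then unilluminated L B = {}
      else hausdorff_dim (unilluminated L B) < ereal \<alpha>)"

definition h_alpha :: "real \<Rightarrow> 'a::euclidean_space set \<Rightarrow> nat" where
  "h_alpha \<alpha> B =
     (if \<alpha> > real DIM('a) then 0
      else (LEAST n. \<exists>L. alpha_illuminating \<alpha> L B \<and> card L = n))"

end

theory Submission
  imports Defs
begin

text \<open>
  Let \<open>0 < \<alpha> \<le> d\<close> and let \<open>L\<close> be a set of directions whose unilluminated set \<open>U\<close> has dimension less
  than \<open>\<alpha>\<close>. Then \<open>U\<close> has \<open>s\<close>-dimensional measure zero for some \<open>s < \<alpha>\<close>, so it has coverings by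
  balls whose radii have arbitrarily small total \<open>\<alpha>\<close>-th power. A ball of radius \<open>\<rho>\<close> fits into a
  homothet of \<open>B\<close> with ratio proportional to \<open>\<rho>\<close>, so \<open>U\<close> lies in the interiors of
  homothets of total cost at most \<open>\<epsilon>\<close>; finitely many suffice because illumination by a direction
  is an open condition on the point, which makes \<open>U\<close> compact
  (\<open>hausdorff_null_homothet_cover\<close>).

  What those interiors leave of \<open>B\<close> is a compact set \<open>K\<close>, each point of which is illuminated by
  some \<open>l \<in> L\<close>, interior points by every direction. By compactness one step length \<open>t\<close> serves all
  of \<open>K\<close>, so \<open>K\<close> is covered by the translates \<open>interior B - t l\<close>. Shrinking \<open>B\<close>
  slightly towards an interior point still leaves a cover, again by compactness. Thus \<open>card L\<close>
  homothets of ratio below 1, each of cost at most 1, cover \<open>K\<close>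
  (\<open>illuminated_compact_cover\<close>). Together the two families give
  \<open>g_alpha \<alpha> B \<le> card L + \<epsilon>\<close>. For \<open>\<alpha> = 0\<close> the set \<open>U\<close> is empty and the second step alone suffices.

  Two points remain. The least element defining \<open>h_alpha\<close> has to exist, which follows from a finite
  illuminating set obtained by aiming at an interior point (\<open>finite_illumination\<close>). For \<open>\<alpha> > d\<close>,
  covering \<open>B\<close> by a grid of order \<open>n ^ d\<close> homothets of ratio of order \<open>1 / n\<close> shows that
  the infimum is at most 0 (\<open>g_alpha_nonpos_above_dim\<close>).
\<close>

section \<open>Finite families of homothets\<close>

text \<open>
  A homothet is coded by its ratio and translation vector. Families are finite sets of such codes
  instead of indexed sequences, so that unions and images of families need no renumbering; merging
  equal members can only lower the cost.
\<close>

definition homothet :: "'a::real_vector set \<Rightarrow> real \<times> 'a \<Rightarrow> 'a set" where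
  "homothet B p = (\<lambda>b. fst p *\<^sub>R b + snd p) ` B"

definition contractions :: "(real \<times> 'a) set \<Rightarrow> bool" where
  "contractions F \<longleftrightarrow> finite F \<and> (\<forall>p\<in>F. 0 < fst p \<and> fst p < 1)"

definition cost :: "real \<Rightarrow> (real \<times> 'a) set \<Rightarrow> real" where
  "cost \<alpha> F = (\<Sum>p\<in>F. fst p powr \<alpha>)"

lemma contractions_Un: "contractions F \<Longrightarrow> contractions G \<Longrightarrow> contractions (F \<union> G)"
  by (auto simp: contractions_def)

lemma cost_Un_le:
  assumes "contractions F" "contractions G"
  shows "cost \<alpha> (F \<union> G) \<le> cost \<alpha> F + cost \<alpha> G"
proof -
  have "0 \<le> (\<Sum>p\<in>F \<inter> G. fst p powr \<alpha>)" by (simp add: sum_nonneg)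
  then show ?thesis
    using assms by (simp add: contractions_def cost_def sum_Un)
qed

lemma cost_image_le:
  assumes "finite I"
  shows "cost \<alpha> (f ` I) \<le> (\<Sum>i\<in>I. fst (f i) powr \<alpha>)"
  unfolding cost_def using sum_image_le[OF assms, of "\<lambda>p. fst p powr \<alpha>" f]
  by (simp add: o_def)

text \<open>
  The bridge to the indexed covers in the definition of \<open>g_alpha\<close>: enumerate the finite set.
\<close>

lemma g_alpha_le_cost:
  assumes F: "contractions F" and cov: "B \<subseteq> (\<Union>p\<in>F. homothet B p)"
  shows "g_alpha \<alpha> B \<le> cost \<alpha> F"
proof -
  have "finite F" using F by (simp add: contractions_def)
  then obtain h where h: "bij_betw h {..<card F} F"
    using ex_bij_betw_nat_finite[of F] by (auto simp: atLeast0LessThan)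
  define r where "r = (\<lambda>i. fst (h i))"
  define x where "x = (\<lambda>i. snd (h i))"
  have img: "h ` {..<card F} = F" using h by (simp add: bij_betw_def)
  have sum: "cost \<alpha> F = (\<Sum>i<card F. r i powr \<alpha>)"
    unfolding cost_def r_def using sum.reindex_bij_betw[OF h, of "\<lambda>p. fst p powr \<alpha>"] by simp
  have "B \<subseteq> (\<Union>i<card F. (\<lambda>b. r i *\<^sub>R b + x i) ` B)"
  proof -
    have "(\<Union>p\<in>F. homothet B p) = (\<Union>i<card F. homothet B (h i))"
      by (subst img[symmetric]) blast
    then show ?thesis using cov by (simp add: homothet_def r_def x_def)
  qed
  moreover have "\<forall>i<card F. 0 < r i \<and> r i < 1"
    using F img unfolding contractions_def r_def by (metis imageI lessThan_iff)
  ultimately show ?thesis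
    unfolding g_alpha_def sum
    by (intro cInf_lower bdd_belowI[of _ 0]) (auto intro: sum_nonneg)
qed

text \<open>
  The homothety that carries \<open>cball c r0\<close> onto \<open>cball y \<rho>\<close> carries \<open>B\<close> onto a superset.
\<close>

lemma cball_subset_homothet:
  fixes c :: "'a::euclidean_space"
  assumes "cball c r0 \<subseteq> B" "0 < r0" "0 < \<rho>"
  shows "cball y \<rho> \<subseteq> homothet B (\<rho> / r0, y - (\<rho> / r0) *\<^sub>R c)"
proof
  fix z assume z: "z \<in> cball y \<rho>"
  define b where "b = c + (r0 / \<rho>) *\<^sub>R (z - y)"
  have "norm (b - c) = (r0 / \<rho>) * norm (z - y)"
    using assms by (simp add: b_def)
  also have "\<dots> \<le> (r0 / \<rho>) * \<rho>"
    using z assms by (intro mult_left_mono) (auto simp: dist_norm norm_minus_commute)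
  finally have "b \<in> cball c r0" using assms by (simp add: dist_norm norm_minus_commute)
  moreover have "z = (\<rho> / r0) *\<^sub>R b + (y - (\<rho> / r0) *\<^sub>R c)"
    using assms by (simp add: b_def algebra_simps)
  ultimately show "z \<in> homothet B (\<rho> / r0, y - (\<rho> / r0) *\<^sub>R c)"
    using assms by (auto simp: homothet_def)
qed

lemma homothets_engulfing_balls:
  fixes c :: "'a::euclidean_space"
  assumes "cball c r0 \<subseteq> B" "0 < r0" "finite I" "\<And>i. i \<in> I \<Longrightarrow> 0 < \<rho> i \<and> \<rho> i < r0"
  obtains F where "contractions F"
    "\<And>i. i \<in> I \<Longrightarrow> \<exists>p\<in>F. cball (y i) (\<rho> i) \<subseteq> homothet B p"
    "cost \<alpha> F \<le> (\<Sum>i\<in>I. (\<rho> i / r0) powr \<alpha>)"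
proof
  let ?f = "\<lambda>i. (\<rho> i / r0, y i - (\<rho> i / r0) *\<^sub>R c)"
  show "contractions (?f ` I)" using assms by (auto simp: contractions_def)
  show "\<exists>p\<in>?f ` I. cball (y i) (\<rho> i) \<subseteq> homothet B p" if "i \<in> I" for i
    using cball_subset_homothet[OF assms(1,2)] assms(4)[OF that] that by blast
  show "cost \<alpha> (?f ` I) \<le> (\<Sum>i\<in>I. (\<rho> i / r0) powr \<alpha>)"
    using cost_image_le[OF assms(3), of \<alpha> ?f] by simp
qed

lemma convex_body_contains_cball:
  assumes "convex_body B"
  obtains c r0 where "cball c r0 \<subseteq> B" "0 < r0"
  using assms unfolding convex_body_def by (meson ex_in_conv mem_interior_cball)

section \<open>Illuminated sets\<close>

lemma open_translate_preimage:
  fixes S :: "'a::real_normed_vector set"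
  assumes "open S" shows "open {x. x + v \<in> S}"
  using open_vimage[OF assms, of "\<lambda>x. x + v"] by (simp add: vimage_def continuous_intros)

lemma illuminates_iff: "illuminates l B x \<longleftrightarrow> (\<exists>t>0. x + t *\<^sub>R l \<in> interior B)"
  by (auto simp: illuminates_def)

lemma open_illuminated: "open {x. illuminates l B x}"
proof -
  have "{x. illuminates l B x} = (\<Union>t\<in>{0<..}. {x. x + t *\<^sub>R l \<in> interior B})"
    by (auto simp: illuminates_iff)
  then show ?thesis by (auto intro!: open_UN open_translate_preimage)
qed

text \<open>
  Compactness of the dark set is what reduces the countable covers of Hausdorff measure to the
  finite covers allowed in \<open>g_alpha\<close>.
\<close>

lemma compact_unilluminated:
  assumes "convex_body B" shows "compact (unilluminated L B)"
proof -
  have "unilluminated L B = frontier B - (\<Union>l\<in>L. {x. illuminates l B x})"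
    by (auto simp: unilluminated_def)
  moreover have "compact (frontier B)" using assms by (simp add: convex_body_def compact_frontier)
  ultimately show ?thesis by (auto intro!: compact_diff open_UN open_illuminated)
qed

lemma interior_illuminated:
  assumes "x \<in> interior B" shows "illuminates l B x"
proof -
  have "((\<lambda>t. x + t *\<^sub>R l) \<longlongrightarrow> x + 0 *\<^sub>R l) (at_right (0::real))"
    by (intro tendsto_intros)
  then have "\<forall>\<^sub>F t in at_right 0. x + t *\<^sub>R l \<in> interior B"
    using assms by (auto dest!: topological_tendstoD[where S="interior B"])
  then have "\<forall>\<^sub>F t in at_right (0::real). 0 < t \<and> x + t *\<^sub>R l \<in> interior B"
    using eventually_at_right_less[of "0::real"] by eventually_elim auto
  then show ?thesis
    unfolding illuminates_iff using eventually_happens by fastforce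
qed

text \<open>
  Monotonicity is asked for on \<open>K\<close> only: the sets used for a uniform step length increase
  inside \<open>B\<close> but not outside.
\<close>

lemma compact_covered_by_increasing:
  fixes W :: "nat \<Rightarrow> 'a::topological_space set"
  assumes "compact K" "\<And>n. open (W n)" "K \<subseteq> (\<Union>n. W n)"
    and inc: "\<And>m n. m \<le> n \<Longrightarrow> K \<inter> W m \<subseteq> W n"
  obtains n where "K \<subseteq> W n"
proof -
  obtain D where D: "finite D" "K \<subseteq> (\<Union>n\<in>D. W n)"
    using compactE_image[OF assms(1), of UNIV W] assms(2,3) by (metis subset_UNIV)
  have "K \<subseteq> W (Max (insert 0 D))"
  proof
    fix x assume "x \<in> K"
    then obtain m where "m \<in> D" "x \<in> W m" using D by auto
    then show "x \<in> W (Max (insert 0 D))"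
      using inc[of m "Max (insert 0 D)"] D \<open>x \<in> K\<close> by auto
  qed
  then show ?thesis by (rule that)
qed

text \<open>
  If a step of length \<open>t\<close> leads from a point of \<open>B\<close> to the interior, then so does every shorter
  step, by convexity. The sets of points served by the step length \<open>1 / (n + 1)\<close> therefore increase
  with \<open>n\<close> on \<open>K\<close>, and compactness picks out one of them.
\<close>

lemma uniform_illumination:
  fixes B :: "'a::euclidean_space set"
  assumes B: "convex B" and K: "compact K" "K \<subseteq> B"
    and ill: "\<And>x. x \<in> K \<Longrightarrow> \<exists>l\<in>L. illuminates l B x"
  obtains t where "t > 0" "\<And>x. x \<in> K \<Longrightarrow> \<exists>l\<in>L. x + t *\<^sub>R l \<in> interior B"
proof -
  have shrink: "x + s *\<^sub>R l \<in> interior B"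
    if "x \<in> B" "x + t *\<^sub>R l \<in> interior B" "0 < s" "s \<le> t" for x l s t
  proof -
    have "x - (s / t) *\<^sub>R (x - (x + t *\<^sub>R l)) \<in> interior B"
      using that B by (intro mem_interior_convex_shrink) auto
    then show ?thesis using that by simp
  qed
  define \<tau> where "\<tau> = (\<lambda>n. 1 / (real n + 1))"
  define W where "W = (\<lambda>n. \<Union>l\<in>L. {x. x + \<tau> n *\<^sub>R l \<in> interior B})"
  have "K \<subseteq> (\<Union>n. W n)"
  proof
    fix x assume x: "x \<in> K"
    then obtain l t where l: "l \<in> L" "0 < t" "x + t *\<^sub>R l \<in> interior B"
      using ill[OF x] unfolding illuminates_iff by blast
    obtain n where "inverse (of_nat (Suc n)) < t" using l reals_Archimedean by blast
    then have "\<tau> n \<le> t" by (simp add: \<tau>_def field_simps)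
    then have "x + \<tau> n *\<^sub>R l \<in> interior B"
      using shrink[of x t l "\<tau> n"] l x K by (auto simp: \<tau>_def)
    then show "x \<in> (\<Union>n. W n)" using l by (auto simp: W_def)
  qed
  moreover have "K \<inter> W m \<subseteq> W n" if "m \<le> n" for m n
  proof -
    have "0 < \<tau> n" "\<tau> n \<le> \<tau> m" using that by (auto simp: \<tau>_def field_simps)
    then show ?thesis using shrink K by (fastforce simp: W_def)
  qed
  moreover have "open (W n)" for n
    by (auto simp: W_def intro!: open_UN open_translate_preimage)
  ultimately obtain n where "K \<subseteq> W n" using compact_covered_by_increasing[OF K(1)] by metis
  then show ?thesis by (intro that[of "\<tau> n"]) (auto simp: W_def \<tau>_def)
qed

text \<open>
  With a uniform step length \<open>t\<close>, each \<open>x \<in> K\<close> satisfies \<open>x \<in> interior B - t l\<close> for some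
  \<open>l \<in> L\<close>. Fix \<open>q\<close> in the interior. A point of the interior stays there under a slight dilation
  about \<open>q\<close>; by compactness a single dilation factor \<open>1 + e n\<close> works for all of \<open>K\<close>.
  The inverse dilation, composed with the translation by \<open>- t l\<close>, is then a contraction for
  each \<open>l\<close>, and their images of \<open>B\<close> cover \<open>K\<close>.
\<close>

lemma illuminated_compact_cover:
  fixes B :: "'a::euclidean_space set"
  assumes B: "convex_body B" and K: "compact K" "K \<subseteq> B"
    and L: "finite L" and ill: "\<And>x. x \<in> K \<Longrightarrow> \<exists>l\<in>L. illuminates l B x"
  obtains F where "contractions F" "K \<subseteq> (\<Union>p\<in>F. homothet B p)" "card F \<le> card L"
proof -
  have cB: "convex B" using B by (simp add: convex_body_def)
  obtain q where q: "q \<in> interior B" using B by (auto simp: convex_body_def)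
  obtain t where t: "t > 0" "\<And>x. x \<in> K \<Longrightarrow> \<exists>l\<in>L. x + t *\<^sub>R l \<in> interior B"
    using uniform_illumination[OF cB K ill] by metis
  define e where "e = (\<lambda>n. 1 / (real n + 1))"
  \<comment> \<open>\<open>D n\<close> is the dilation about \<open>q\<close> by the factor \<open>1 + e n\<close>.\<close>
  define D where "D = (\<lambda>n y. y + e n *\<^sub>R (y - q))"
  define W where "W = (\<lambda>n. \<Union>l\<in>L. {x. D n (x + t *\<^sub>R l) \<in> interior B})"
  have inc: "W m \<subseteq> W n" if "m \<le> n" for m n
  proof -
    have "D n y \<in> interior B" if "D m y \<in> interior B" for y
    proof -
      \<comment> \<open>The weaker dilation \<open>D n y\<close> lies on the segment from \<open>q\<close> to \<open>D m y\<close>, at parameter \<open>u\<close>.\<close>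
      define u where "u = (1 + e n) / (1 + e m)"
      have "0 < e n" "0 < e m" "e n \<le> e m" using \<open>m \<le> n\<close> by (auto simp: e_def field_simps)
      then have u: "0 \<le> u" "u \<le> 1" "u * (1 + e m) = 1 + e n" by (auto simp: u_def)
      have "(1 - u) *\<^sub>R q + u *\<^sub>R D m y \<in> interior B"
        using convex_interior[OF cB] q that u by (intro convexD) auto
      moreover have "(1 - u) *\<^sub>R q + u *\<^sub>R D m y = q + (u * (1 + e m)) *\<^sub>R (y - q)"
        by (simp add: D_def algebra_simps)
      moreover have "\<dots> = D n y" unfolding u by (simp add: D_def algebra_simps)
      ultimately show ?thesis by simp
    qed
    then show ?thesis by (auto simp: W_def)
  qed
  have "open (W n)" for n
  proof -
    have "open ((\<lambda>x. D n (x + t *\<^sub>R l)) -` interior B)" for l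
      unfolding D_def by (intro open_vimage continuous_intros) auto
    then show ?thesis by (auto simp: W_def vimage_def)
  qed
  moreover have "K \<subseteq> (\<Union>n. W n)"
  proof
    fix x assume "x \<in> K"
    then obtain l where l: "l \<in> L" "x + t *\<^sub>R l \<in> interior B" using t by blast
    let ?y = "x + t *\<^sub>R l"
    have "e \<longlonglongrightarrow> 0" unfolding e_def
      using LIMSEQ_inverse_real_of_nat by (simp add: inverse_eq_divide add.commute)
    then have "(\<lambda>n. D n ?y) \<longlonglongrightarrow> ?y + 0 *\<^sub>R (?y - q)"
      unfolding D_def by (intro tendsto_intros)
    then have "\<forall>\<^sub>F n in sequentially. D n ?y \<in> interior B"
      using l by (auto dest!: topological_tendstoD[where S="interior B"])
    then obtain n where "D n ?y \<in> interior B" by (auto simp: eventually_sequentially)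
    then show "x \<in> (\<Union>n. W n)" using l by (auto simp: W_def)
  qed
  ultimately obtain n where n: "K \<subseteq> W n"
    using compact_covered_by_increasing[OF K(1), of W] inc by (metis inf.coboundedI2)
  define r where "r = 1 / (1 + e n)"
  define f where "f = (\<lambda>l. (r, (1 - r) *\<^sub>R q - t *\<^sub>R l))"
  have "0 < e n" by (simp add: e_def)
  then have r: "0 < r" "r < 1" "r * (1 + e n) = 1" by (auto simp: r_def)
  show ?thesis
  proof
    show "contractions (f ` L)" using L r by (auto simp: contractions_def f_def)
    show "card (f ` L) \<le> card L" using L by (rule card_image_le)
    show "K \<subseteq> (\<Union>p\<in>f ` L. homothet B p)"
    proof
      fix x assume "x \<in> K"
      then obtain l where l: "l \<in> L" "D n (x + t *\<^sub>R l) \<in> interior B"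
        using n by (auto simp: W_def)
      let ?y = "x + t *\<^sub>R l"
      have "D n ?y = q + (1 + e n) *\<^sub>R (?y - q)" by (simp add: D_def algebra_simps)
      then have "r *\<^sub>R D n ?y + ((1 - r) *\<^sub>R q - t *\<^sub>R l)
          = r *\<^sub>R (q + (1 + e n) *\<^sub>R (?y - q)) + ((1 - r) *\<^sub>R q - t *\<^sub>R l)"
        by (rule arg_cong)
      also have "\<dots> = q + (r * (1 + e n)) *\<^sub>R (?y - q) - t *\<^sub>R l"
        by (simp only: scaleR_add_right scaleR_diff_left scaleR_scaleR scaleR_one) simp
      also have "\<dots> = x" unfolding r by simp
      finally have "x \<in> homothet B (f l)"
        using l interior_subset by (force simp: homothet_def f_def)
      then show "x \<in> (\<Union>p\<in>f ` L. homothet B p)" using l by auto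
    qed
  qed
qed

text \<open>
  Interiors are removed from \<open>B\<close>, so that the rest of \<open>B\<close> is compact. Non-emptiness of \<open>L\<close>
  lets interior points of \<open>B\<close> count as illuminated.
\<close>

lemma g_alpha_le_residual_cover:
  fixes B :: "'a::euclidean_space set"
  assumes B: "convex_body B" and \<alpha>: "\<alpha> \<ge> 0" and L: "finite L" "L \<noteq> {}"
    and G: "contractions G" "unilluminated L B \<subseteq> (\<Union>p\<in>G. interior (homothet B p))"
  shows "g_alpha \<alpha> B \<le> real (card L) + cost \<alpha> G"
proof -
  define K where "K = B - (\<Union>p\<in>G. interior (homothet B p))"
  have cB: "compact B" using B by (simp add: convex_body_def)
  have K: "compact K" "K \<subseteq> B" using cB by (auto simp: K_def intro!: compact_diff)
  have ill: "\<exists>l\<in>L. illuminates l B x" if "x \<in> K" for x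
  proof (cases "x \<in> interior B")
    case True
    then show ?thesis using L interior_illuminated by blast
  next
    case False
    then have "x \<in> frontier B"
      using that closure_subset by (auto simp: frontier_def K_def)
    then show ?thesis using that G by (auto simp: unilluminated_def K_def)
  qed
  obtain F where F: "contractions F" "K \<subseteq> (\<Union>p\<in>F. homothet B p)" "card F \<le> card L"
    using illuminated_compact_cover[OF B K L(1) ill] by metis
  have "B \<subseteq> (\<Union>p\<in>F \<union> G. homothet B p)"
  proof
    fix x assume "x \<in> B"
    show "x \<in> (\<Union>p\<in>F \<union> G. homothet B p)"
    proof (cases "x \<in> K")
      case True
      then show ?thesis using F by blast
    next
      case False
      then show ?thesis using \<open>x \<in> B\<close> interior_subset by (fastforce simp: K_def)
    qed
  qed
  then have "g_alpha \<alpha> B \<le> cost \<alpha> (F \<union> G)"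
    by (intro g_alpha_le_cost contractions_Un F G)
  also have "\<dots> \<le> cost \<alpha> F + cost \<alpha> G" by (intro cost_Un_le F G)
  also have "cost \<alpha> F \<le> (\<Sum>p\<in>F. 1)"
    unfolding cost_def using F(1) \<alpha>
    by (intro sum_mono powr_le1) (auto simp: contractions_def less_imp_le)
  also have "\<dots> \<le> real (card L)" using F by simp
  finally show ?thesis by simp
qed

section \<open>Null sets of Hausdorff measure\<close>

text \<open>
  Sets of small diameter contribute less at a larger exponent; at \<open>s = 0\<close> the convention that
  non-empty sets contribute 1 makes this true as well.
\<close>

lemma powr_le_diam_power:
  assumes "U \<noteq> {}" "0 \<le> diameter U" "diameter U \<le> 1" "0 \<le> s" "s \<le> \<alpha>"
  shows "ennreal (diameter U powr \<alpha>) \<le> diam_power s U"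
proof (cases "s = 0")
  case True
  have "diameter U powr \<alpha> \<le> 1" using assms by (intro powr_le1) auto
  then show ?thesis using assms True by (simp add: diam_power_def)
next
  case False
  have "diameter U powr \<alpha> \<le> diameter U powr s"
  proof (cases "diameter U = 0")
    case False
    then show ?thesis using assms by (intro powr_mono') auto
  qed simp
  then show ?thesis using assms False by (simp add: diam_power_def ennreal_leI)
qed

text \<open>
  Used to pass from diameters, which may vanish, to strictly larger radii at negligible cost.
\<close>

lemma powr_right_approx:
  fixes d :: real
  assumes "0 \<le> d" "0 < \<alpha>" "0 < \<epsilon>" "d < m"
  obtains \<rho> where "d < \<rho>" "\<rho> < m" "\<rho> powr \<alpha> < d powr \<alpha> + \<epsilon>"
proof -
  have "((\<lambda>x. x powr \<alpha>) \<longlongrightarrow> d powr \<alpha>) (at_right d)"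
    by (rule tendsto_powr') (use assms in \<open>auto intro!: tendsto_intros
        eventually_mono[OF eventually_at_right_less]\<close>)
  then have "\<forall>\<^sub>F x in at_right d. x powr \<alpha> < d powr \<alpha> + \<epsilon>"
    using assms by (intro order_tendstoD) auto
  moreover have "\<forall>\<^sub>F x in at_right d. x < m"
    using assms(4) by (auto simp: eventually_at_right_field)
  moreover have "\<forall>\<^sub>F x in at_right d. d < x" by (rule eventually_at_right_less)
  ultimately have "\<forall>\<^sub>F x in at_right d. d < x \<and> x < m \<and> x powr \<alpha> < d powr \<alpha> + \<epsilon>"
    by eventually_elim auto
  then show ?thesis using that eventually_happens by fastforce
qed

text \<open>
  Put around a point of each \<open>U i\<close> in a cheap cover an open ball with radius just above the
  diameter of \<open>U i\<close>. The sets \<open>U i\<close> use up half of \<open>\<epsilon>\<close>; a geometric series bounds the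
  total excess in the powers of the radii by the other half. Since the balls are open, finitely
  many suffice.
\<close>

lemma hausdorff_null_ball_cover:
  fixes A :: "'a::euclidean_space set"
  assumes A: "compact A" "hausdorff_measure s A = 0" and s: "0 \<le> s" "s \<le> \<alpha>" "0 < \<alpha>"
    and pos: "0 < m" "0 < \<epsilon>"
  obtains P where "finite P" "\<And>p. p \<in> P \<Longrightarrow> 0 < snd p \<and> snd p < m"
    "A \<subseteq> (\<Union>p\<in>P. ball (fst p) (snd p))" "(\<Sum>p\<in>P. snd p powr \<alpha>) < \<epsilon>"
proof -
  define \<delta> where "\<delta> = min 1 (m / 2)"
  have \<delta>: "0 < \<delta>" "\<delta> \<le> 1" "\<delta> < m" using pos by (auto simp: \<delta>_def)
  have "hausdorff_premeasure s \<delta> A \<le> hausdorff_measure s A"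
    unfolding hausdorff_measure_def using \<delta> by (intro SUP_upper) auto
  then have "hausdorff_premeasure s \<delta> A < ennreal (\<epsilon> / 2)" using A pos by simp
  then obtain U where U: "A \<subseteq> (\<Union>i. U i)" "\<And>i. bounded (U i)" "\<And>i. diameter (U i) \<le> \<delta>"
    and Usum: "(\<Sum>i. diam_power s (U i)) < ennreal (\<epsilon> / 2)"
    unfolding hausdorff_premeasure_def INF_less_iff by auto
  define d where "d = (\<lambda>i. diameter (U i))"
  have d: "0 \<le> d i" "d i \<le> 1" "d i < m" for i
    using U(3)[of i] \<delta> diameter_ge_0[OF U(2)[of i]] by (auto simp: d_def)
  have "\<exists>x. d i < x \<and> x < m \<and> x powr \<alpha> < d i powr \<alpha> + \<epsilon> / 2 * (1/2) ^ Suc i" for i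
    using powr_right_approx[OF d(1) s(3) _ d(3), of "\<epsilon> / 2 * (1/2) ^ Suc i"] pos
    by (metis half_gt_zero mult_pos_pos zero_less_divide_1_iff zero_less_numeral zero_less_power)
  then obtain \<rho> where \<rho>: "\<And>i. d i < \<rho> i" "\<And>i. \<rho> i < m"
      "\<And>i. \<rho> i powr \<alpha> < d i powr \<alpha> + \<epsilon> / 2 * (1/2) ^ Suc i" by metis
  define y where "y = (\<lambda>i. SOME x. x \<in> U i)"
  \<comment> \<open>Empty members cost 0 only as sets; as balls they would not, so they are dropped.\<close>
  define J where "J = {i. U i \<noteq> {}}"
  have sub: "U i \<subseteq> ball (y i) (\<rho> i)" for i
  proof
    fix x assume x: "x \<in> U i"
    then have "y i \<in> U i" unfolding y_def by (rule someI)
    then have "dist (y i) x \<le> d i"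
      unfolding d_def using x U(2) by (intro diameter_bounded_bound)
    then show "x \<in> ball (y i) (\<rho> i)" using \<rho>(1)[of i] by simp
  qed
  have "A \<subseteq> (\<Union>i\<in>J. ball (y i) (\<rho> i))"
    using U(1) sub unfolding J_def by blast
  then obtain I where I: "I \<subseteq> J" "finite I" "A \<subseteq> (\<Union>i\<in>I. ball (y i) (\<rho> i))"
    using compactE_image[OF A(1), of J "\<lambda>i. ball (y i) (\<rho> i)"] by auto
  have "ennreal (\<Sum>i\<in>I. d i powr \<alpha>) = (\<Sum>i\<in>I. ennreal (d i powr \<alpha>))"
    by (simp add: sum_ennreal)
  also have "\<dots> \<le> (\<Sum>i\<in>I. diam_power s (U i))"
    using I d s unfolding d_def J_def by (intro sum_mono powr_le_diam_power) auto
  also have "\<dots> \<le> (\<Sum>i. diam_power s (U i))"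
    using I by (intro sum_le_suminf) auto
  finally have "ennreal (\<Sum>i\<in>I. d i powr \<alpha>) < ennreal (\<epsilon> / 2)" using Usum by simp
  then have 1: "(\<Sum>i\<in>I. d i powr \<alpha>) < \<epsilon> / 2"
    using pos by (simp add: ennreal_less_iff sum_nonneg)
  have "(\<Sum>i\<in>I. (1/2::real) ^ Suc i) \<le> 1"
    using sum_le_suminf[OF sums_summable[OF power_half_series] I(2)] 
      sums_unique[OF power_half_series] by simp
  then have 2: "\<epsilon> / 2 * (\<Sum>i\<in>I. (1/2::real) ^ Suc i) \<le> \<epsilon> / 2"
    using pos mult_left_le[of "\<Sum>i\<in>I. (1/2::real) ^ Suc i" "\<epsilon> / 2"] by simp
  have "(\<Sum>i\<in>I. \<rho> i powr \<alpha>) \<le> (\<Sum>i\<in>I. d i powr \<alpha> + \<epsilon> / 2 * (1/2) ^ Suc i)"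
    using \<rho>(3) by (intro sum_mono less_imp_le)
  also have "\<dots> = (\<Sum>i\<in>I. d i powr \<alpha>) + \<epsilon> / 2 * (\<Sum>i\<in>I. (1/2) ^ Suc i)"
    by (simp only: sum.distrib sum_distrib_left)
  also have "\<dots> < \<epsilon>" using 1 2 by linarith
  finally have 3: "(\<Sum>i\<in>I. \<rho> i powr \<alpha>) < \<epsilon>" .
  have 4: "0 < \<rho> i \<and> \<rho> i < m" for i using \<rho>(1,2)[of i] d(1)[of i] by linarith
  let ?P = "(\<lambda>i. (y i, \<rho> i)) ` I"
  show ?thesis
  proof (rule that)
    show "finite ?P" using I by simp
    show "0 < snd p \<and> snd p < m" if "p \<in> ?P" for p using that 4 by auto
    show "A \<subseteq> (\<Union>p\<in>?P. ball (fst p) (snd p))" using I by simp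
    have "(\<Sum>p\<in>?P. snd p powr \<alpha>) \<le> (\<Sum>i\<in>I. \<rho> i powr \<alpha>)"
      using sum_image_le[OF I(2), of "\<lambda>p. snd p powr \<alpha>" "\<lambda>i. (y i, \<rho> i)"] by (simp add: o_def)
    with 3 show "(\<Sum>p\<in>?P. snd p powr \<alpha>) < \<epsilon>" by linarith
  qed
qed

lemma hausdorff_null_homothet_cover:
  fixes B :: "'a::euclidean_space set"
  assumes B: "convex_body B" and A: "compact A" "hausdorff_measure s A = 0"
    and s: "0 \<le> s" "s \<le> \<alpha>" "0 < \<alpha>" and \<epsilon>: "0 < \<epsilon>"
  obtains G where "contractions G" "A \<subseteq> (\<Union>p\<in>G. interior (homothet B p))" "cost \<alpha> G \<le> \<epsilon>"
proof -
  obtain c r0 where c: "cball c r0 \<subseteq> B" "0 < r0" using B by (rule convex_body_contains_cball)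
  have pos: "0 < \<epsilon> * r0 powr \<alpha>" using \<epsilon> c by simp
  obtain P where P: "finite P" "\<And>p. p \<in> P \<Longrightarrow> 0 < snd p \<and> snd p < r0"
    "A \<subseteq> (\<Union>p\<in>P. ball (fst p) (snd p))" "(\<Sum>p\<in>P. snd p powr \<alpha>) < \<epsilon> * r0 powr \<alpha>"
    by (rule hausdorff_null_ball_cover[OF A s c(2) pos]) (rule that)
  obtain G where G: "contractions G"
    "\<And>p. p \<in> P \<Longrightarrow> \<exists>h\<in>G. cball (fst p) (snd p) \<subseteq> homothet B h"
    "cost \<alpha> G \<le> (\<Sum>p\<in>P. (snd p / r0) powr \<alpha>)"
    by (rule homothets_engulfing_balls[where y = fst and \<rho> = snd and \<alpha> = \<alpha>, OF c P(1,2)])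
      (assumption, rule that)
  have "(\<Sum>p\<in>P. (snd p / r0) powr \<alpha>) = (\<Sum>p\<in>P. snd p powr \<alpha>) / r0 powr \<alpha>"
    unfolding sum_divide_distrib using P c by (intro sum.cong refl powr_divide)
  also have "\<dots> \<le> \<epsilon>" using P(4) c by (simp add: divide_le_eq)
  finally have "cost \<alpha> G \<le> \<epsilon>" using G(3) by linarith
  moreover have "A \<subseteq> (\<Union>p\<in>G. interior (homothet B p))"
  proof
    fix x assume "x \<in> A"
    then obtain p where p: "p \<in> P" "x \<in> ball (fst p) (snd p)" using P(3) by blast
    then obtain h where h: "h \<in> G" "cball (fst p) (snd p) \<subseteq> homothet B h" using G(2) by blast
    have "ball (fst p) (snd p) \<subseteq> interior (homothet B h)"
      using interior_mono[OF h(2)] by simp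
    then show "x \<in> (\<Union>p\<in>G. interior (homothet B p))" using h(1) p(2) by blast
  qed
  ultimately show ?thesis using that G(1) by metis
qed

section \<open>Exponents above the dimension\<close>

text \<open>
  Round each coordinate down to a multiple of \<open>1 / n\<close>. The crude count
  \<open>2 M n + 1 \<le> (2 M + 1) n\<close> per coordinate isolates the power \<open>n ^ d\<close>.
\<close>

lemma grid_cover:
  fixes B :: "'a::euclidean_space set"
  assumes M: "\<And>x. x \<in> B \<Longrightarrow> norm x \<le> real M" and n: "0 < n"
  obtains Z where "finite Z" "card Z \<le> ((2 * M + 1) * n) ^ DIM('a)"
    "B \<subseteq> (\<Union>z\<in>Z. cball z (real DIM('a) / real n))"
proof -
  define P where "P = (Basis :: 'a set) \<rightarrow>\<^sub>E {- int (M * n)..int (M * n)}"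
  define pt :: "('a \<Rightarrow> int) \<Rightarrow> 'a" where "pt = (\<lambda>k. \<Sum>b\<in>Basis. (k b / real n) *\<^sub>R b)"
  have fP: "finite P" unfolding P_def by (intro finite_PiE) auto
  have "card P = (2 * M * n + 1) ^ DIM('a)"
    unfolding P_def by (subst card_PiE) (auto simp: nat_add_distrib nat_mult_distrib algebra_simps)
  also have "\<dots> \<le> ((2 * M + 1) * n) ^ DIM('a)"
    using n by (intro power_mono) (auto simp: algebra_simps)
  finally have "card (pt ` P) \<le> ((2 * M + 1) * n) ^ DIM('a)"
    using card_image_le[OF fP, of pt] by linarith
  moreover have "B \<subseteq> (\<Union>z\<in>pt ` P. cball z (real DIM('a) / real n))"
  proof
    fix x assume x: "x \<in> B"
    define k where "k = (\<lambda>b\<in>Basis. \<lfloor>real n * (x \<bullet> b)\<rfloor>)"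
    have "k \<in> P"
      unfolding P_def k_def
    proof (intro restrict_PiE_iff[THEN iffD2] ballI)
      fix b :: 'a assume b: "b \<in> Basis"
      have "\<bar>x \<bullet> b\<bar> \<le> real M" using Basis_le_norm[OF b, of x] M[OF x] by linarith
      then have "real n * \<bar>x \<bullet> b\<bar> \<le> real n * real M" by (intro mult_left_mono) auto
      then have "\<bar>real n * (x \<bullet> b)\<bar> \<le> real (M * n)" by (simp add: abs_mult mult.commute)
      then have "- real (M * n) \<le> real n * (x \<bullet> b)" "real n * (x \<bullet> b) \<le> real (M * n)" by linarith+
      then have "- int (M * n) \<le> \<lfloor>real n * (x \<bullet> b)\<rfloor>" "\<lfloor>real n * (x \<bullet> b)\<rfloor> \<le> int (M * n)"
        by linarith+
      then show "\<lfloor>real n * (x \<bullet> b)\<rfloor> \<in> {- int (M * n)..int (M * n)}" by simp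
    qed
    moreover have "norm (x - pt k) \<le> real DIM('a) / real n"
    proof -
      have "norm (x - pt k) \<le> (\<Sum>b\<in>Basis. \<bar>(x - pt k) \<bullet> b\<bar>)" by (rule norm_le_l1)
      also have "\<dots> \<le> (\<Sum>b\<in>(Basis::'a set). 1 / real n)"
      proof (intro sum_mono)
        fix b :: 'a assume b: "b \<in> Basis"
        have "pt k \<bullet> b = \<lfloor>real n * (x \<bullet> b)\<rfloor> / real n"
          unfolding pt_def using b by (simp add: k_def)
        then have "(x - pt k) \<bullet> b = (real n * (x \<bullet> b) - \<lfloor>real n * (x \<bullet> b)\<rfloor>) / real n"
          using n by (simp add: inner_diff_left diff_divide_distrib)
        moreover have "\<bar>real n * (x \<bullet> b) - \<lfloor>real n * (x \<bullet> b)\<rfloor>\<bar> \<le> 1" by linarith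
        ultimately show "\<bar>(x - pt k) \<bullet> b\<bar> \<le> 1 / real n"
          using n by (simp add: abs_divide divide_right_mono)
      qed
      finally show ?thesis by simp
    qed
    ultimately show "x \<in> (\<Union>z\<in>pt ` P. cball z (real DIM('a) / real n))"
      by (auto simp: dist_norm norm_minus_commute)
  qed
  ultimately show ?thesis using that fP by blast
qed

text \<open>
  The grid gives families of cost at most a constant times \<open>n powr (d - \<alpha>)\<close>, which tends to 0.
\<close>

lemma g_alpha_nonpos_above_dim:
  fixes B :: "'a::euclidean_space set"
  assumes B: "convex_body B" and \<alpha>: "\<alpha> > real DIM('a)"
  shows "g_alpha \<alpha> B \<le> 0"
proof -
  let ?d = "DIM('a)"
  obtain c r0 where c: "cball c r0 \<subseteq> B" "0 < r0" using B by (rule convex_body_contains_cball)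
  have "bounded B" using B by (simp add: convex_body_def compact_imp_bounded)
  then obtain a where a: "\<And>x. x \<in> B \<Longrightarrow> norm x \<le> a" by (auto simp: bounded_iff)
  obtain M :: nat where "a \<le> real M" using real_arch_simple by blast
  then have M: "\<And>x. x \<in> B \<Longrightarrow> norm x \<le> real M" using a order_trans by blast
  define C where "C = real (2 * M + 1) ^ ?d * (real ?d / r0) powr \<alpha>"
  have bound: "g_alpha \<alpha> B \<le> C * real n powr (real ?d - \<alpha>)" if n: "real n > real ?d / r0" for n
  proof -
    have n0: "0 < n" using n c by (cases n) (auto simp: field_simps)
    let ?\<rho> = "real ?d / real n"
    obtain Z where Z: "finite Z" "card Z \<le> ((2 * M + 1) * n) ^ ?d" "B \<subseteq> (\<Union>z\<in>Z. cball z ?\<rho>)"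
      using grid_cover[OF M n0] by metis
    have \<rho>: "0 < ?\<rho> \<and> ?\<rho> < r0" using n n0 c by (auto simp: field_simps)
    obtain F where F: "contractions F" "\<And>z. z \<in> Z \<Longrightarrow> \<exists>p\<in>F. cball z ?\<rho> \<subseteq> homothet B p"
      "cost \<alpha> F \<le> (\<Sum>z\<in>Z. (?\<rho> / r0) powr \<alpha>)"
      using homothets_engulfing_balls[OF c Z(1), of "\<lambda>_. ?\<rho>" "\<lambda>z. z" \<alpha>] \<rho> by metis
    have "B \<subseteq> (\<Union>p\<in>F. homothet B p)" using Z(3) F(2) by blast
    then have "g_alpha \<alpha> B \<le> cost \<alpha> F" by (intro g_alpha_le_cost F)
    also have "\<dots> \<le> real (card Z) * (?\<rho> / r0) powr \<alpha>" using F(3) by simp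
    also have "\<dots> \<le> real (((2 * M + 1) * n) ^ ?d) * (?\<rho> / r0) powr \<alpha>"
      using Z(2) by (intro mult_right_mono) (auto simp only: of_nat_le_iff powr_ge_zero)
    also have "?\<rho> / r0 = (real ?d / r0) / real n" by simp
    also have "((real ?d / r0) / real n) powr \<alpha> = (real ?d / r0) powr \<alpha> / real n powr \<alpha>"
      using c by (intro powr_divide) 
    also have "real (((2 * M + 1) * n) ^ ?d) * ((real ?d / r0) powr \<alpha> / real n powr \<alpha>)
        = C * (real n ^ ?d / real n powr \<alpha>)"
    proof -
      have "real (((2 * M + 1) * n) ^ ?d) = real (2 * M + 1) ^ ?d * real n ^ ?d"
        by (simp only: of_nat_power of_nat_mult power_mult_distrib)
      then show ?thesis unfolding C_def by (simp only: times_divide_eq_right times_divide_eq_left mult_ac)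
    qed
    also have "real n ^ ?d / real n powr \<alpha> = real n powr (real ?d - \<alpha>)"
      using n0 by (simp add: powr_diff powr_realpow)
    finally show ?thesis .
  qed
  have "(\<lambda>n. C * real n powr (real ?d - \<alpha>)) \<longlonglongrightarrow> C * 0"
    using \<alpha> by (intro tendsto_intros tendsto_neg_powr filterlim_real_sequentially) auto
  moreover have "\<forall>\<^sub>F n in sequentially. real ?d / r0 < real n"
    using filterlim_real_sequentially by (auto simp: filterlim_at_top_dense)
  then have "\<forall>\<^sub>F n in sequentially. g_alpha \<alpha> B \<le> C * real n powr (real ?d - \<alpha>)"
    by eventually_elim (rule bound)
  ultimately show ?thesis using tendsto_lowerbound by fastforce
qed

section \<open>Illuminating sets and the bound\<close>

text \<open>
  A boundary point \<open>x\<close> is illuminated by the direction towards a fixed interior point \<open>q\<close>,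
  and that direction still illuminates a neighbourhood of \<open>x\<close>.
\<close>

lemma finite_illumination:
  fixes B :: "'a::euclidean_space set"
  assumes B: "convex_body B"
  obtains L where "finite L" "L \<noteq> {}" "\<forall>l\<in>L. norm l = 1" "unilluminated L B = {}"
proof -
  obtain q where q: "q \<in> interior B" using B by (auto simp: convex_body_def)
  have cf: "compact (frontier B)" using B by (simp add: convex_body_def compact_frontier)
  have aim: "illuminates (sgn (q - x)) B x \<and> norm (sgn (q - x)) = 1" if "x \<in> frontier B" for x
  proof -
    have "x \<noteq> q" using that q by (auto simp: frontier_def)
    then have "x + norm (q - x) *\<^sub>R sgn (q - x) = q" "norm (q - x) > 0"
      by (auto simp: sgn_div_norm)
    then show ?thesis using q \<open>x \<noteq> q\<close> unfolding illuminates_iff by (metis norm_sgn norm_eq_zero less_irrefl)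
  qed
  let ?N = "\<lambda>x. {z. illuminates (sgn (q - x)) B z}"
  have "frontier B \<subseteq> (\<Union>x\<in>frontier B. ?N x)" using aim by blast
  then obtain X where X: "X \<subseteq> frontier B" "finite X" "frontier B \<subseteq> (\<Union>x\<in>X. ?N x)"
    using compactE_image[OF cf, of "frontier B" ?N] open_illuminated by metis
  obtain u :: 'a where u: "norm u = 1" using vector_choose_size[of 1] by auto
  show ?thesis
  proof
    \<comment> \<open>\<open>u\<close> keeps the set of directions non-empty, whatever \<open>X\<close> is.\<close>
    let ?L = "insert u ((\<lambda>x. sgn (q - x)) ` X)"
    show "finite ?L" "?L \<noteq> {}" using X by auto
    show "\<forall>l\<in>?L. norm l = 1" using u aim X by auto
    show "unilluminated ?L B = {}" using X by (auto simp: unilluminated_def)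
  qed
qed

lemma hausdorff_measure_empty: "hausdorff_measure s ({} :: 'a::metric_space set) = 0"
proof -
  have "hausdorff_premeasure s \<delta> ({} :: 'a set) = 0" if "\<delta> > 0" for \<delta>
  proof -
    have "hausdorff_premeasure s \<delta> ({} :: 'a set) \<le> (\<Sum>i::nat. diam_power s ({} :: 'a set))"
      unfolding hausdorff_premeasure_def
      by (rule INF_lower2[of "\<lambda>_. {}"]) (use that in \<open>auto simp: diameter_def\<close>)
    then show ?thesis by (simp add: diam_power_def)
  qed
  then show ?thesis by (auto simp: hausdorff_measure_def intro!: antisym SUP_least)
qed

lemma hausdorff_dim_lessE:
  assumes "hausdorff_dim A < ereal \<alpha>"
  obtains s where "0 \<le> s" "s < \<alpha>" "hausdorff_measure s A = 0"
  using assms by (auto simp: hausdorff_dim_def INF_less_iff)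

text \<open>
  Without this, the least cardinality in \<open>h_alpha\<close> would be an unspecified number.
\<close>

lemma alpha_illuminating_exists:
  fixes B :: "'a::euclidean_space set"
  assumes "convex_body B" "\<alpha> \<ge> 0"
  shows "\<exists>L. alpha_illuminating \<alpha> L B"
proof -
  obtain L where L: "finite L" "L \<noteq> {}" "\<forall>l\<in>L. norm l = 1" "unilluminated L B = {}"
    using assms(1) by (rule finite_illumination)
  have "hausdorff_dim ({} :: 'a set) \<le> ereal 0"
    unfolding hausdorff_dim_def by (rule INF_lower) (simp add: hausdorff_measure_empty)
  then have "hausdorff_dim ({} :: 'a set) < ereal \<alpha>" if "\<alpha> \<noteq> 0"
    using that assms(2) by (elim le_less_trans) auto
  then show ?thesis using L by (auto simp: alpha_illuminating_def)
qed

text \<open>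
  For \<open>\<alpha> = 0\<close> nothing is left dark and the empty family suffices; otherwise the dimension bound
  makes the dark set null for an exponent below \<open>\<alpha>\<close>.
\<close>

lemma g_alpha_le_card_illuminating:
  fixes B :: "'a::euclidean_space set"
  assumes B: "convex_body B" and \<alpha>: "\<alpha> \<ge> 0" and L: "alpha_illuminating \<alpha> L B"
  shows "g_alpha \<alpha> B \<le> real (card L)"
proof (rule field_le_epsilon)
  fix \<epsilon> :: real assume \<epsilon>: "0 < \<epsilon>"
  have fin: "finite L" "L \<noteq> {}" using L by (auto simp: alpha_illuminating_def)
  obtain G where G: "contractions G" "unilluminated L B \<subseteq> (\<Union>p\<in>G. interior (homothet B p))"
    "cost \<alpha> G \<le> \<epsilon>"
  proof (cases "\<alpha> = 0")
    case True
    then have "unilluminated L B = {}" using L by (simp add: alpha_illuminating_def)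
    then show ?thesis using that[of "{}"] \<epsilon> by (simp add: contractions_def cost_def)
  next
    case False
    then obtain s where "0 \<le> s" "s < \<alpha>" "hausdorff_measure s (unilluminated L B) = 0"
      using L by (auto simp: alpha_illuminating_def elim: hausdorff_dim_lessE)
    then show ?thesis
      using hausdorff_null_homothet_cover[OF B compact_unilluminated[OF B], of s L \<alpha> \<epsilon>] \<epsilon> that
      by auto
  qed
  show "g_alpha \<alpha> B \<le> real (card L) + \<epsilon>"
    using g_alpha_le_residual_cover[OF B \<alpha> fin G(1,2)] G(3) by linarith
qed

theorem theorem1:
  fixes B :: "'a::euclidean_space set" and \<alpha> :: real
  assumes "convex_body B"
    and "\<alpha> \<ge> 0"
  shows "g_alpha \<alpha> B \<le> real (h_alpha \<alpha> B)"
proof (cases "\<alpha> > real DIM('a)")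
  case True
  then show ?thesis using g_alpha_nonpos_above_dim[OF assms(1)] by (simp add: h_alpha_def)
next
  case False
  have "\<exists>n L. alpha_illuminating \<alpha> L B \<and> card L = n"
    using alpha_illuminating_exists[OF assms] by blast
  then have "\<exists>L. alpha_illuminating \<alpha> L B \<and> card L = h_alpha \<alpha> B"
    unfolding h_alpha_def using False by (simp only: if_False) (rule LeastI_ex)
  then show ?thesis using g_alpha_le_card_illuminating[OF assms] by metis
qed

end
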